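(* Every class $\mathcal C$ of graphs with $\sup_{G\in\mathcal C}\mathrm{smw}_1(G)<\infty$ admits an adjacency labelling scheme of length $O(\log n)$.
   Context: Graphs are finite, simple, undirected. For a partition $\mathcal P$ of $V(G)$ and $X\subseteq V(G)$, $X/\mathcal P$ is the set of parts of $\mathcal P$ intersecting $X$. For $R\subseteq\binom{V(G)}2$, $\mathrm{Ball}^r_R(v)$ is the radius-$r$ ball around $v$ in $(V(G),R)$. $\mathcal P$ is homogeneous modulo $R$ if for all parts $X,Y$ (possibly equal), the pairs $\{x,y\}$, $x\in X,y\in Y$, $x\ne y$, not in $R$ are all edges or all non-edges of $G$. A merge sequence for $G$ is $(\mathcal P_1,R_1),\dots,(\mathcal P_m,R_m)$ with $\mathcal P_1\preceq\dots\preceq\mathcal P_m$ partitions of $V(G)$, $\mathcal P_1$ into singletons, $\mathcal P_m=\{V(G)\}$, $R_1\subseteq\dots\subseteq R_m$, $\mathcal P_t$ homogeneous modulo $R_t$; $m$ is its length; its radius-$r$ width is $\max_{t<m}\max_v|\mathrm{Ball}^r_{R_{t+1}}(v)/\mathcal P_t|$; its valency is the least $\Delta$ such that for every $i\in[m-1]$ each part of $\mathcal P_{i+1}$ is a union of at most $\Delta$ parts of $\mathcal P_i$. The radius-$r$ short merge-width $\mathrm{smw}_r(G)$ is the least $k$ such that $G$ has a merge sequence of radius-$r$ width at most $k$, valency at most $k$, and length at most $k\log_2|V(G)|+k$. A labelling scheme for $\mathcal C$ is a pair of functions: an encoder assigning to each $G\in\mathcal C$ and $u\in V(G)$ a binary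 word $\mathcal E_G(u)$, and a decoder mapping pairs of binary words to accept/reject, such that for every $G\in\mathcal C$ and distinct $u,v\in V(G)$, $uv\in E(G)$ iff the decoder accepts $(\mathcal E_G(u),\mathcal E_G(v))$. Its length is $\ell(n)=\max\{|\mathcal E_G(u)|: G\in\mathcal C, |V(G)|=n, u\in V(G)\}$; no computability requirements are imposed. *)

theory Defs
  imports
    Complex_Main
    "HOL-Library.Disjoint_Sets"
    "HOL-Library.Ramsey"
    "HOL-Library.Extended_Nat"
    "HOL-Library.Landau_Symbols"
begin

type_synonym 'a graph = "'a set \<times> 'a set set"

abbreviation verts :: "'a graph \<Rightarrow> 'a set" where "verts \<equiv> fst"

abbreviation edges :: "'a graph \<Rightarrow> 'a set set" where "edges \<equiv> snd"

definition simple_graph :: "'a graph \<Rightarrow> bool" where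
  "simple_graph G \<longleftrightarrow> finite (verts G) \<and> edges G \<subseteq> [verts G]\<^bsup>2\<^esup>"

definition parts_meeting :: "'a set \<Rightarrow> 'a set set \<Rightarrow> 'a set set" where
  "parts_meeting X P = {Y \<in> P. Y \<inter> X \<noteq> {}}"

definition pair_ball :: "'a set set \<Rightarrow> nat \<Rightarrow> 'a \<Rightarrow> 'a set" where
  "pair_ball R r v = {w. \<exists>i\<le>r. (v, w) \<in> {(x, y). {x, y} \<in> R} ^^ i}"

definition homogeneous_modulo :: "'a graph \<Rightarrow> 'a set set \<Rightarrow> 'a set set \<Rightarrow> bool" where
  "homogeneous_modulo G R P \<longleftrightarrow> (\<forall>X\<in>P. \<forall>Y\<in>P.
     (\<forall>x\<in>X. \<forall>y\<in>Y. x \<noteq> y \<and> {x, y} \<notin> R \<longrightarrow> {x, y} \<in> edges G) \<or>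
     (\<forall>x\<in>X. \<forall>y\<in>Y. x \<noteq> y \<and> {x, y} \<notin> R \<longrightarrow> {x, y} \<notin> edges G))"

text \<open>
  A merge sequence of length \<open>m\<close> consists of the pairs \<open>(P t, R t)\<close> for \<open>1 \<le> t \<le> m\<close>; the values
  of \<open>P\<close> and \<open>R\<close> at other indices are irrelevant.
\<close>

definition merge_sequence ::
    "'a graph \<Rightarrow> nat \<Rightarrow> (nat \<Rightarrow> 'a set set) \<Rightarrow> (nat \<Rightarrow> 'a set set) \<Rightarrow> bool" where
  "merge_sequence G m P R \<longleftrightarrow>
     1 \<le> m \<and>
     (\<forall>t\<in>{1..m}. partition_on (verts G) (P t)) \<and>
     (\<forall>t\<in>{1..m}. R t \<subseteq> [verts G]\<^bsup>2\<^esup>) \<and>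
     P 1 = {{v} | v. v \<in> verts G} \<and>
     P m = {verts G} \<and>
     (\<forall>t\<in>{1..<m}. refines (verts G) (P t) (P (t + 1))) \<and>
     (\<forall>t\<in>{1..<m}. R t \<subseteq> R (t + 1)) \<and>
     (\<forall>t\<in>{1..m}. homogeneous_modulo G (R t) (P t))"

text \<open>
  The suprema below are over finite sets of naturals when \<open>G\<close> is finite, hence maxima, with value
  \<open>0\<close> in the case \<open>m = 1\<close> where there is nothing to maximise over.
\<close>

definition radius_width ::
    "nat \<Rightarrow> 'a graph \<Rightarrow> nat \<Rightarrow> (nat \<Rightarrow> 'a set set) \<Rightarrow> (nat \<Rightarrow> 'a set set) \<Rightarrow> nat" where
  "radius_width r G m P R =
     (SUP t\<in>{1..<m}. SUP v\<in>verts G. card (parts_meeting (pair_ball (R (t + 1)) r v) (P t)))"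

definition valency :: "nat \<Rightarrow> (nat \<Rightarrow> 'a set set) \<Rightarrow> nat" where
  "valency m P = (LEAST \<Delta>. \<forall>i\<in>{1..<m}. \<forall>Y\<in>P (i + 1).
     \<exists>Q\<subseteq>P i. finite Q \<and> card Q \<le> \<Delta> \<and> Y = \<Union>Q)"

text \<open>The value is \<open>\<infinity>\<close> if no suitable \<open>k\<close> exists.\<close>

definition short_merge_width :: "nat \<Rightarrow> 'a graph \<Rightarrow> enat" where
  "short_merge_width r G = Inf {enat k | k. \<exists>m P R.
     merge_sequence G m P R \<and>
     radius_width r G m P R \<le> k \<and>
     valency m P \<le> k \<and>
     real m \<le> real k * log 2 (real (card (verts G))) + real k}"

definition labelling_scheme ::
    "'a graph set \<Rightarrow> ('a graph \<Rightarrow> 'a \<Rightarrow> bool list) \<Rightarrow> (bool list \<Rightarrow> bool list \<Rightarrow> bool) \<Rightarrow> bool" where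
  "labelling_scheme \<C> enc dec \<longleftrightarrow>
     (\<forall>G\<in>\<C>. \<forall>u\<in>verts G. \<forall>v\<in>verts G. u \<noteq> v \<longrightarrow>
        ({u, v} \<in> edges G \<longleftrightarrow> dec (enc G u) (enc G v)))"

text \<open>
  Over an infinite vertex type a class can contain infinitely many graphs of a given order, so the
  length is taken in the extended naturals.
\<close>

definition scheme_length ::
    "'a graph set \<Rightarrow> ('a graph \<Rightarrow> 'a \<Rightarrow> bool list) \<Rightarrow> nat \<Rightarrow> enat" where
  "scheme_length \<C> enc n =
     Sup {enat (length (enc G u)) | G u. G \<in> \<C> \<and> card (verts G) = n \<and> u \<in> verts G}"

end

theory Submission
  imports Defs "HOL-Library.Countable_Set"
begin

text \<open>
  Number the children of every node of the merge tree. A vertex \<open>u\<close> is then described by its branch,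
  the word of child numbers on the way from the root \<open>V(G)\<close> to the leaf \<open>{u}\<close>. Fix a vertex \<open>v\<close> and
  call a part of \<open>P t\<close> nearby if it meets the ball of radius 1 around \<open>v\<close> in \<open>R (t + 1)\<close>. Suppose
  that the branch of \<open>u\<close>, read from the root, runs through nearby parts up to \<open>X \<in> P t\<close> and leaves
  them below \<open>X\<close>. Then either \<open>t = 1\<close> and \<open>X = {u}\<close>, or \<open>{u, v} \<notin> R t\<close>, and by homogeneity a
  single bit stored at \<open>X\<close> decides whether \<open>u\<close> and \<open>v\<close> are adjacent. As boundedly many parts are
  nearby on each level, this process is a layered automaton of bounded width that reads the branch
  of \<open>u\<close>. The label of a vertex consists of its branch and its automaton, both of which are words
  over a finite alphabet and at most as long as the merge sequence.
\<close>

section \<open>Widths of merge sequences\<close>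

lemma mem_pair_ball_1: "w \<in> pair_ball R 1 v \<longleftrightarrow> w = v \<or> {v, w} \<in> R"
proof -
  have "(\<exists>i\<le>1. Q i) \<longleftrightarrow> Q 0 \<or> Q 1" for Q :: "nat \<Rightarrow> bool"
    by (auto simp: le_Suc_eq)
  then show ?thesis
    unfolding pair_ball_def by auto
qed

lemma card_parts_meeting_le_radius_width:
  assumes "finite (verts G)" and "t \<in> {1..<m}" and "v \<in> verts G"
  shows "card (parts_meeting (pair_ball (R (t + 1)) r v) (P t)) \<le> radius_width r G m P R"
proof -
  let ?f = "\<lambda>t v. card (parts_meeting (pair_ball (R (t + 1)) r v) (P t))"
  have "?f t v \<le> (SUP v\<in>verts G. ?f t v)"
    using assms by (intro cSUP_upper bdd_above_finite) auto
  also have "\<dots> \<le> (SUP t\<in>{1..<m}. SUP v\<in>verts G. ?f t v)"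
    using assms by (intro cSUP_upper[of t "{1..<m}"] bdd_above_finite) auto
  finally show ?thesis unfolding radius_width_def .
qed

lemma short_merge_width_leE:
  assumes "short_merge_width r G \<le> enat K"
  obtains m P R where "merge_sequence G m P R" "radius_width r G m P R \<le> K" "valency m P \<le> K"
    "real m \<le> real K * log 2 (real (card (verts G))) + real K"
proof -
  define admissible where "admissible k \<longleftrightarrow> (\<exists>m P R. merge_sequence G m P R \<and>
    radius_width r G m P R \<le> k \<and> valency m P \<le> k \<and>
    real m \<le> real k * log 2 (real (card (verts G))) + real k)" for k
  have "Inf {enat k | k. admissible k} < enat (Suc K)"
    using assms unfolding short_merge_width_def admissible_def
    by (rule le_less_trans) simp
  then obtain k where "admissible k" "k \<le> K"
    unfolding Inf_less_iff by auto
  moreover have "0 \<le> log 2 (real (card (verts G)))"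
    by (cases "card (verts G)") (auto simp: log_def)
  then have "real k * log 2 (real (card (verts G))) + real k
      \<le> real K * log 2 (real (card (verts G))) + real K"
    using \<open>k \<le> K\<close> by (intro add_mono mult_right_mono) auto
  ultimately show thesis
    using that unfolding admissible_def by (meson order_trans)
qed

section \<open>Refinements of partitions\<close>

definition part_of :: "'a set set \<Rightarrow> 'a \<Rightarrow> 'a set" where
  "part_of P v = (THE X. X \<in> P \<and> v \<in> X)"

definition subparts :: "'a set set \<Rightarrow> 'a set \<Rightarrow> 'a set set" where
  "subparts P Y = {X \<in> P. X \<subseteq> Y}"

lemma part_of_eq:
  assumes "partition_on A P" and "X \<in> P" and "v \<in> X"
  shows "part_of P v = X"
  unfolding part_of_def using partition_onD2[OF assms(1)] assms(2,3)
  by (intro the_equality) (auto simp: disjoint_def)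

lemma part_of_mem:
  assumes "partition_on A P" and "v \<in> A"
  shows "part_of P v \<in> P" and "v \<in> part_of P v"
proof -
  obtain X where "X \<in> P" "v \<in> X"
    using partition_onD1[OF assms(1)] assms(2) by auto
  then show "part_of P v \<in> P" "v \<in> part_of P v"
    using part_of_eq[OF assms(1)] by auto
qed

lemma part_of_refines:
  assumes "refines A P Q" and "v \<in> A"
  shows "part_of P v \<in> subparts P (part_of Q v)"
proof -
  have P: "partition_on A P" and Q: "partition_on A Q"
    using assms(1) by (auto simp: refines_def)
  obtain Y where Y: "Y \<in> Q" "part_of P v \<subseteq> Y"
    using assms part_of_mem(1)[OF P] unfolding refines_def by blast
  then have "part_of Q v = Y"
    using part_of_mem(2)[OF P assms(2)] by (intro part_of_eq[OF Q]) auto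
  then show ?thesis
    using Y part_of_mem(1)[OF P assms(2)] by (simp add: subparts_def)
qed

lemma Union_subparts:
  assumes "refines A P Q" and "Y \<in> Q"
  shows "\<Union>(subparts P Y) = Y"
  using partition_onD1[OF refines_obtains_subset[OF assms]] by (simp add: subparts_def)

lemma subparts_Union:
  assumes "partition_on A P" and "Q \<subseteq> P"
  shows "subparts P (\<Union>Q) = Q"
proof
  show "subparts P (\<Union>Q) \<subseteq> Q"
  proof
    fix X assume X: "X \<in> subparts P (\<Union>Q)"
    then have "X \<noteq> {}" "X \<subseteq> \<Union>Q"
      using partition_onD3[OF assms(1)] by (auto simp: subparts_def)
    then obtain x Z where "x \<in> X" "Z \<in> Q" "x \<in> Z" by blast
    then have "Z = X"
      using X assms part_of_eq[OF assms(1)] unfolding subparts_def by blast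
    then show "X \<in> Q" using \<open>Z \<in> Q\<close> by simp
  qed
qed (use assms(2) in \<open>auto simp: subparts_def\<close>)

lemma finite_subparts:
  assumes "finite A" and "partition_on A P"
  shows "finite (subparts P Y)"
  using finite_elements[OF assms] by (simp add: subparts_def)

lemma card_subparts_le_valency:
  assumes "finite V" and chain: "\<And>t. t \<in> {1..<m} \<Longrightarrow> refines V (P t) (P (t + 1))"
    and t: "t \<in> {1..<m}" and Y: "Y \<in> P (t + 1)"
  shows "card (subparts (P t) Y) \<le> valency m P"
proof -
  let ?bound = "\<lambda>\<Delta>. \<forall>i\<in>{1..<m}. \<forall>Y\<in>P (i + 1). \<exists>Q\<subseteq>P i. finite Q \<and> card Q \<le> \<Delta> \<and> Y = \<Union>Q"
  have part: "partition_on V (P i)" if "i \<in> {1..<m}" for i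
    using chain[OF that] by (simp add: refines_def)
  have "?bound (card (Pow V))"
  proof (intro ballI exI conjI)
    fix i Y assume i: "i \<in> {1..<m}" and Y: "Y \<in> P (i + 1)"
    show "subparts (P i) Y \<subseteq> P i" by (auto simp: subparts_def)
    show "finite (subparts (P i) Y)" using finite_subparts[OF assms(1) part[OF i]] .
    have "subparts (P i) Y \<subseteq> Pow V"
      using partition_onD1[OF part[OF i]] by (auto simp: subparts_def)
    then show "card (subparts (P i) Y) \<le> card (Pow V)"
      using assms(1) by (intro card_mono) auto
    show "Y = \<Union>(subparts (P i) Y)" using Union_subparts[OF chain[OF i] Y] by simp
  qed
  then have "?bound (valency m P)" unfolding valency_def by (rule LeastI[of ?bound])
  then obtain Q where "Q \<subseteq> P t" "card Q \<le> valency m P" "Y = \<Union>Q"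
    using t Y by meson
  then show ?thesis using subparts_Union[OF part[OF t]] by simp
qed

definition child_index :: "'a set set \<Rightarrow> 'a set set \<Rightarrow> 'a \<Rightarrow> nat" where
  "child_index P Q v = to_nat_on (subparts P (part_of Q v)) (part_of P v)"

lemma to_nat_on_less_card:
  assumes "finite A" and "a \<in> A"
  shows "to_nat_on A a < card A"
  using bij_betwE[OF to_nat_on_finite[OF assms(1)]] assms(2) by simp

lemma child_index_less:
  assumes "finite A" and "refines A P Q" and "v \<in> A"
  shows "child_index P Q v < card (subparts P (part_of Q v))"
proof -
  have "finite (subparts P (part_of Q v))"
    using assms by (intro finite_subparts) (auto simp: refines_def)
  then show ?thesis
    using part_of_refines[OF assms(2,3)] unfolding child_index_def by (rule to_nat_on_less_card)
qed

lemma part_of_eq_iff_child_index: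
  assumes "finite A" and "refines A P Q" and u: "u \<in> A" and v: "v \<in> A"
  shows "part_of P u = part_of P v \<longleftrightarrow>
    part_of Q u = part_of Q v \<and> child_index P Q u = child_index P Q v"
proof -
  have P: "partition_on A P" and Q: "partition_on A Q"
    using assms(2) by (auto simp: refines_def)
  have sub: "part_of P w \<in> subparts P (part_of Q w)" if "w \<in> A" for w
    using part_of_refines[OF assms(2) that] .
  have "part_of Q u = part_of Q v" if "part_of P u = part_of P v"
  proof (rule part_of_eq[OF Q part_of_mem(1)[OF Q v]])
    show "u \<in> part_of Q v"
      using part_of_mem(2)[OF P u] sub[OF v] that by (auto simp: subparts_def)
  qed
  moreover have "countable (subparts P (part_of Q v))"
    using finite_subparts[OF assms(1) P] by (rule countable_finite)
  ultimately show ?thesis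
    using sub[OF u] sub[OF v] unfolding child_index_def by auto
qed

lemma card_image_le_card_image:
  assumes "finite (g ` B)" and eq: "\<And>x y. x \<in> B \<Longrightarrow> y \<in> B \<Longrightarrow> g x = g y \<Longrightarrow> f x = f y"
  shows "card (f ` B) \<le> card (g ` B)"
proof -
  have "f x = f (inv_into B g (g x))" if "x \<in> B" for x
    using that by (intro eq) (auto intro: inv_into_into simp: f_inv_into_f)
  then have "f ` B \<subseteq> (f \<circ> inv_into B g) ` g ` B" by auto
  then show ?thesis by (rule surj_card_le[OF assms(1)])
qed

section \<open>Layered automata for sets of words\<close>

primrec walk :: "'b list set \<Rightarrow> 'b list \<Rightarrow> 'b list \<Rightarrow> 'b list" where
  "walk W w [] = w"
| "walk W w (x # xs) = (if w @ [x] \<in> W then walk W (w @ [x]) xs else w)"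

lemma walk_cases:
  obtains i where "i \<le> length xs" "walk W w xs = w @ take i xs"
    "i < length xs \<Longrightarrow> w @ take (Suc i) xs \<notin> W"
proof (induction xs arbitrary: w thesis)
  case Nil
  then show ?case by simp
next
  case (Cons x xs)
  show ?case
  proof (cases "w @ [x] \<in> W")
    case True
    obtain i where "i \<le> length xs" "walk W (w @ [x]) xs = (w @ [x]) @ take i xs"
      "i < length xs \<Longrightarrow> (w @ [x]) @ take (Suc i) xs \<notin> W"
      using Cons.IH by blast
    then show ?thesis using True by (intro Cons.prems[of "Suc i"]) auto
  next
    case False
    then show ?thesis by (intro Cons.prems[of 0]) auto
  qed
qed

text \<open>
  The first component of a table is the transition relation from one layer of states to the next;
  the second one is the set of states that accept if no transition is possible.
\<close>

type_synonym 'b table = "(nat \<times> 'b \<times> nat) set \<times> nat set"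

definition tables :: "nat \<Rightarrow> 'b set \<Rightarrow> 'b table set" where
  "tables s A = Pow ({..<s} \<times> A \<times> {..<s}) \<times> Pow {..<s}"

fun run :: "nat \<Rightarrow> 'b table list \<Rightarrow> 'b list \<Rightarrow> bool" where
  "run q [] xs \<longleftrightarrow> False"
| "run q (T # Ts) [] \<longleftrightarrow> q \<in> snd T"
| "run q (T # Ts) (x # xs) \<longleftrightarrow>
     (if \<exists>q'. (q, x, q') \<in> fst T then \<exists>q'. (q, x, q') \<in> fst T \<and> run q' Ts xs else q \<in> snd T)"

definition level :: "'b list set \<Rightarrow> nat \<Rightarrow> 'b list set" where
  "level W n = {w \<in> W. length w = n}"

definition state :: "'b list set \<Rightarrow> 'b list \<Rightarrow> nat" where
  "state W w = to_nat_on (level W (length w)) w"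

definition table :: "'b list set \<Rightarrow> 'b list set \<Rightarrow> nat \<Rightarrow> 'b table" where
  "table W F n =
     ({(state W w, x, state W (w @ [x])) | w x. w \<in> level W n \<and> w @ [x] \<in> W},
      state W ` (level W n \<inter> F))"

lemma state_less_card_level:
  assumes "finite (level W (length w))" and "w \<in> W"
  shows "state W w < card (level W (length w))"
  unfolding state_def using assms by (intro to_nat_on_less_card) (simp_all add: level_def)

lemma state_eq_iff:
  assumes "finite (level W n)" and "v \<in> level W n" and "w \<in> level W n"
  shows "state W v = state W w \<longleftrightarrow> v = w"
  using assms countable_finite[OF assms(1)] unfolding state_def by (simp add: level_def)

lemma table_mem_tables:
  assumes "W \<subseteq> lists A" and "\<And>n. finite (level W n)" and "\<And>n. card (level W n) \<le> s"
  shows "table W F n \<in> tables s A"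
proof -
  have "state W w < s" if "w \<in> W" for w
    using state_less_card_level[OF assms(2) that] assms(3) by (rule order_less_le_trans)
  then show ?thesis
    using assms(1) unfolding table_def tables_def level_def by fastforce
qed

lemma mem_fst_table_iff:
  assumes "finite (level W (length w))" and "w \<in> W"
  shows "(state W w, x, q) \<in> fst (table W F (length w)) \<longleftrightarrow> w @ [x] \<in> W \<and> q = state W (w @ [x])"
  using state_eq_iff[OF assms(1), of w] assms(2) unfolding table_def level_def by fastforce

lemma mem_snd_table_iff:
  assumes "finite (level W (length w))" and "w \<in> W"
  shows "state W w \<in> snd (table W F (length w)) \<longleftrightarrow> w \<in> F"
  using state_eq_iff[OF assms(1), of w] assms(2) unfolding table_def level_def by fastforce

lemma run_tables_iff_walk:
  assumes fin: "\<And>n. finite (level W n)" and "w \<in> W" and "length w + length xs < n"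
  shows "run (state W w) (map (table W F) [length w..<n]) xs \<longleftrightarrow> walk W w xs \<in> F"
  using assms(2,3)
proof (induction xs arbitrary: w)
  case Nil
  then show ?case using fin by (simp add: upt_conv_Cons mem_snd_table_iff)
next
  case (Cons x xs)
  then have "run (state W (w @ [x])) (map (table W F) [Suc (length w)..<n]) xs
      \<longleftrightarrow> walk W (w @ [x]) xs \<in> F" if "w @ [x] \<in> W"
    using Cons.IH[OF that] by simp
  then show ?case
    using Cons.prems fin by (simp add: upt_conv_Cons mem_fst_table_iff mem_snd_table_iff)
qed

lemma state_Nil:
  assumes "[] \<in> W"
  shows "state W [] = 0"
proof -
  have "level W 0 = {[]}" using assms by (auto simp: level_def)
  then show ?thesis using state_less_card_level[of W "[]"] assms by simp
qed

section \<open>Deciding adjacency along a merge sequence\<close>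

locale graph_merge_sequence =
  fixes G :: "'a graph" and m :: nat and P R :: "nat \<Rightarrow> 'a set set"
  assumes simple: "simple_graph G" and sequence: "merge_sequence G m P R"
begin

lemma finite_verts: "finite (verts G)"
  using simple by (simp add: simple_graph_def)

lemma length_ge_1: "1 \<le> m"
  using sequence by (simp add: merge_sequence_def)

lemma partition: "t \<in> {1..m} \<Longrightarrow> partition_on (verts G) (P t)"
  using sequence by (simp add: merge_sequence_def)

lemma refines_Suc: "t \<in> {1..<m} \<Longrightarrow> refines (verts G) (P t) (P (t + 1))"
  using sequence by (simp add: merge_sequence_def)

lemma part_of_first: "v \<in> verts G \<Longrightarrow> part_of (P 1) v = {v}"
  using sequence partition[of 1] length_ge_1
  by (intro part_of_eq) (auto simp: merge_sequence_def)

lemma part_of_last: "v \<in> verts G \<Longrightarrow> part_of (P m) v = verts G"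
  using sequence partition[of m] length_ge_1
  by (intro part_of_eq) (auto simp: merge_sequence_def)

lemma pair_ball_subset_verts:
  assumes "t \<in> {1..m}" and "v \<in> verts G"
  shows "pair_ball (R t) 1 v \<subseteq> verts G"
proof
  fix w assume "w \<in> pair_ball (R t) 1 v"
  moreover have "R t \<subseteq> [verts G]\<^bsup>2\<^esup>"
    using sequence assms(1) by (simp add: merge_sequence_def)
  ultimately show "w \<in> verts G"
    using assms(2) unfolding mem_pair_ball_1 nsets_def by auto
qed

lemma homogeneous_part:
  assumes "t \<in> {1..m}" and "v \<in> verts G" and "u \<in> verts G" and "w \<in> verts G"
    and "part_of (P t) w = part_of (P t) u"
    and "v \<noteq> u" "{v, u} \<notin> R t" and "v \<noteq> w" "{v, w} \<notin> R t"
  shows "{v, u} \<in> edges G \<longleftrightarrow> {v, w} \<in> edges G"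
proof -
  have "homogeneous_modulo G (R t) (P t)"
    using sequence assms(1) by (simp add: merge_sequence_def)
  moreover have "part_of (P t) v \<in> P t" "v \<in> part_of (P t) v"
    "part_of (P t) u \<in> P t" "u \<in> part_of (P t) u" "w \<in> part_of (P t) u"
    using part_of_mem[OF partition[OF assms(1)]] assms(2-5) by metis+
  ultimately show ?thesis
    using assms(6-9) unfolding homogeneous_modulo_def by blast
qed

definition branch :: "nat \<Rightarrow> 'a \<Rightarrow> nat list" where
  "branch t v = map (\<lambda>s. child_index (P s) (P (s + 1)) v) (rev [t..<m])"

lemma length_branch: "length (branch t v) = m - t"
  by (simp add: branch_def)

lemma take_branch:
  assumes "i < m"
  shows "take i (branch 1 v) = branch (m - i) v"
proof -
  have "1 + (m - 1 - i) = m - i" using assms by simp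
  then show ?thesis by (simp add: branch_def take_map take_rev)
qed

lemma branch_in_lists:
  assumes "1 \<le> t" and "v \<in> verts G"
  shows "branch t v \<in> lists {..<valency m P}"
proof -
  have "child_index (P s) (P (s + 1)) v < valency m P" if s: "s \<in> {1..<m}" for s
  proof -
    have "child_index (P s) (P (s + 1)) v < card (subparts (P s) (part_of (P (s + 1)) v))"
      using child_index_less[OF finite_verts refines_Suc[OF s] assms(2)] .
    also have "\<dots> \<le> valency m P"
      using part_of_mem(1)[OF partition assms(2)] s
      by (intro card_subparts_le_valency[OF finite_verts] refines_Suc) auto
    finally show ?thesis .
  qed
  then show ?thesis using assms(1) by (auto simp: branch_def)
qed

lemma branch_eq_iff:
  assumes "1 \<le> t" and "t \<le> m" and "u \<in> verts G" and "v \<in> verts G"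
  shows "branch t u = branch t v \<longleftrightarrow> part_of (P t) u = part_of (P t) v"
  using assms(2,1)
proof (induction t rule: inc_induct)
  case base
  then show ?case using assms(3,4) by (simp add: branch_def part_of_last)
next
  case (step t)
  then have t: "t \<in> {1..<m}" by simp
  have branch_Suc: "branch t w = branch (t + 1) w @ [child_index (P t) (P (t + 1)) w]" for w
    using step.hyps by (simp add: branch_def upt_conv_Cons)
  show ?case
    using step.IH unfolding branch_Suc
      part_of_eq_iff_child_index[OF finite_verts refines_Suc[OF t] assms(3,4)] by auto
qed

definition nearby_branches :: "'a \<Rightarrow> nat list set" where
  "nearby_branches v =
     insert [] {branch t w | t w. t \<in> {1..<m} \<and> w \<in> pair_ball (R (t + 1)) 1 v}"

text \<open>The pairs in \<open>R 1\<close> need not be excluded, since the parts of \<open>P 1\<close> are singletons.\<close>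

definition adjacent_branches :: "'a \<Rightarrow> nat list set" where
  "adjacent_branches v = {branch t w | t w. t \<in> {1..m} \<and> w \<in> verts G \<and> w \<noteq> v \<and>
     (t = 1 \<or> {v, w} \<notin> R t) \<and> {v, w} \<in> edges G}"

lemma nearby_branches_subset_lists:
  assumes "v \<in> verts G"
  shows "nearby_branches v \<subseteq> lists {..<valency m P}"
proof -
  have "branch t w \<in> lists {..<valency m P}"
    if t: "t \<in> {1..<m}" and w: "w \<in> pair_ball (R (t + 1)) 1 v" for t w
    using t w pair_ball_subset_verts[OF _ assms, of "t + 1"] by (intro branch_in_lists) auto
  then show ?thesis by (auto simp: nearby_branches_def)
qed

lemma card_branches_pair_ball_le:
  assumes t: "t \<in> {1..<m}" and v: "v \<in> verts G"
  shows "card (branch t ` pair_ball (R (t + 1)) 1 v) \<le> radius_width 1 G m P R"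
proof -
  let ?B = "pair_ball (R (t + 1)) 1 v"
  have B: "?B \<subseteq> verts G"
    using pair_ball_subset_verts[OF _ v, of "t + 1"] t by simp
  have meeting: "part_of (P t) ` ?B \<subseteq> parts_meeting ?B (P t)"
    using part_of_mem[OF partition, of t] B t by (fastforce simp: parts_meeting_def)
  have finite: "finite (parts_meeting ?B (P t))"
    using finite_elements[OF finite_verts partition, of t] t by (simp add: parts_meeting_def)
  have "branch t x = branch t y" if "x \<in> ?B" "y \<in> ?B" "part_of (P t) x = part_of (P t) y" for x y
    using branch_eq_iff[of t x y] subsetD[OF B] that t by simp
  then have "card (branch t ` ?B) \<le> card (part_of (P t) ` ?B)"
    by (rule card_image_le_card_image[OF finite_subset[OF meeting finite]])
  also have "\<dots> \<le> card (parts_meeting ?B (P t))"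
    using finite meeting by (rule card_mono)
  also have "\<dots> \<le> radius_width 1 G m P R"
    using finite_verts t v by (rule card_parts_meeting_le_radius_width)
  finally show ?thesis .
qed

lemma level_nearby_branches_subset:
  "level (nearby_branches v) n \<subseteq>
     (if n \<in> {1..<m} then branch (m - n) ` pair_ball (R (m - n + 1)) 1 v else {[]})"
proof
  fix w assume "w \<in> level (nearby_branches v) n"
  then consider "w = []" "n = 0"
    | t u where "t \<in> {1..<m}" "u \<in> pair_ball (R (t + 1)) 1 v" "w = branch t u" "n = m - t"
    by (auto simp: level_def nearby_branches_def length_branch)
  then show "w \<in> (if n \<in> {1..<m} then branch (m - n) ` pair_ball (R (m - n + 1)) 1 v else {[]})"
    by cases auto
qed

lemma level_nearby_branches:
  assumes v: "v \<in> verts G"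
  shows "finite (level (nearby_branches v) n)"
    and "card (level (nearby_branches v) n) \<le> Suc (radius_width 1 G m P R)"
proof -
  let ?L = "if n \<in> {1..<m} then branch (m - n) ` pair_ball (R (m - n + 1)) 1 v else {[]}"
  have "finite ?L"
    using finite_subset[OF pair_ball_subset_verts[OF _ v] finite_verts, of "m - n + 1"] by auto
  moreover have "card ?L \<le> Suc (radius_width 1 G m P R)"
  proof (cases "n \<in> {1..<m}")
    case True
    then have "card (branch (m - n) ` pair_ball (R (m - n + 1)) 1 v) \<le> radius_width 1 G m P R"
      by (intro card_branches_pair_ball_le[OF _ v]) auto
    then show ?thesis using True by simp
  qed auto
  ultimately show "finite (level (nearby_branches v) n)"
    "card (level (nearby_branches v) n) \<le> Suc (radius_width 1 G m P R)"
    using level_nearby_branches_subset[of v n] by (meson finite_subset card_mono order_trans)+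
qed

lemma branch_mem_adjacent_branches_iff:
  assumes t: "t \<in> {1..m}" and "u \<in> verts G" "v \<in> verts G" "u \<noteq> v" and "t = 1 \<or> {v, u} \<notin> R t"
  shows "branch t u \<in> adjacent_branches v \<longleftrightarrow> {v, u} \<in> edges G"
proof
  assume "{v, u} \<in> edges G"
  then show "branch t u \<in> adjacent_branches v"
    using assms by (auto simp: adjacent_branches_def)
next
  assume "branch t u \<in> adjacent_branches v"
  then obtain s w where s: "s \<in> {1..m}" and w: "w \<in> verts G" "w \<noteq> v" "s = 1 \<or> {v, w} \<notin> R s"
    and vw: "{v, w} \<in> edges G" and branch: "branch t u = branch s w"
    by (auto simp: adjacent_branches_def)
  have "s = t"
    using arg_cong[OF branch, of length] s t by (simp add: length_branch) linarith
  then have part: "part_of (P t) w = part_of (P t) u"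
    using branch branch_eq_iff[of t u w] t assms(2) w(1) by simp
  show "{v, u} \<in> edges G"
  proof (cases "t = 1")
    case True
    then show ?thesis using part part_of_first assms(2) w(1) vw by simp
  next
    case False
    then show ?thesis
      using homogeneous_part[OF t _ _ _ part] assms w vw \<open>s = t\<close> by auto
  qed
qed

lemma adjacent_iff_walk:
  assumes "u \<in> verts G" "v \<in> verts G" "u \<noteq> v"
  shows "{u, v} \<in> edges G \<longleftrightarrow> walk (nearby_branches v) [] (branch 1 u) \<in> adjacent_branches v"
proof -
  obtain i where i: "i \<le> length (branch 1 u)"
    and walk: "walk (nearby_branches v) [] (branch 1 u) = take i (branch 1 u)"
    and stop: "i < length (branch 1 u) \<Longrightarrow> take (Suc i) (branch 1 u) \<notin> nearby_branches v"
    using walk_cases[of "branch 1 u" "nearby_branches v" "[]"] by auto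
  define t where "t = m - i"
  have t: "t \<in> {1..m}" and "i < m"
    using i length_ge_1 by (auto simp: t_def length_branch)
  have "{v, u} \<notin> R t" if "t \<noteq> 1"
  proof
    assume "{v, u} \<in> R t"
    then have "u \<in> pair_ball (R (t - 1 + 1)) 1 v"
      unfolding mem_pair_ball_1 using t by simp
    moreover have "t - 1 \<in> {1..<m}"
      using that t by auto
    ultimately have "branch (t - 1) u \<in> nearby_branches v"
      unfolding nearby_branches_def by blast
    moreover have "take (Suc i) (branch 1 u) = branch (t - 1) u"
      using take_branch[of "Suc i" u] that t by (simp add: t_def)
    moreover have "i < m - 1" using that t by (auto simp: t_def)
    ultimately show False
      using stop by (simp add: length_branch)
  qed
  then have "branch t u \<in> adjacent_branches v \<longleftrightarrow> {v, u} \<in> edges G"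
    using assms by (intro branch_mem_adjacent_branches_iff[OF t]) auto
  then show ?thesis
    using walk take_branch[OF \<open>i < m\<close>] by (simp add: t_def insert_commute)
qed

end

section \<open>Labels\<close>

definition decodes_adjacency ::
    "('l \<Rightarrow> 'l \<Rightarrow> bool) \<Rightarrow> 'a graph \<Rightarrow> ('a \<Rightarrow> 'l) \<Rightarrow> bool" where
  "decodes_adjacency dec G label \<longleftrightarrow>
     (\<forall>u\<in>verts G. \<forall>v\<in>verts G. u \<noteq> v \<longrightarrow> ({u, v} \<in> edges G \<longleftrightarrow> dec (label u) (label v)))"

lemma labelling_scheme_iff:
  "labelling_scheme \<C> enc dec \<longleftrightarrow> (\<forall>G\<in>\<C>. decodes_adjacency dec G (enc G))"
  by (simp add: labelling_scheme_def decodes_adjacency_def)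

definition label_alphabet :: "nat \<Rightarrow> (nat + nat table) set" where
  "label_alphabet k = {..<k} <+> tables (Suc k) {..<k}"

lemma finite_label_alphabet: "finite (label_alphabet k)"
  unfolding label_alphabet_def tables_def
  by (intro finite_Plus finite_cartesian_product) auto

definition run_labels :: "('b + 'b table) list \<Rightarrow> ('b + 'b table) list \<Rightarrow> bool" where
  "run_labels a b = run 0 (map projr (filter (\<lambda>x. \<not> isl x) b)) (map projl (filter isl a))"

lemma run_labels_append:
  "run_labels (map Inl xs @ map Inr Ts) (map Inl ys @ map Inr Us) = run 0 Us xs"
  by (simp add: run_labels_def filter_map comp_def)

lemma (in graph_merge_sequence) run_labels_decodes_adjacency:
  assumes "radius_width 1 G m P R \<le> k" and "valency m P \<le> k"
  shows "\<exists>label. decodes_adjacency run_labels G label \<and>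
    (\<forall>v\<in>verts G. label v \<in> lists (label_alphabet k) \<and> length (label v) \<le> 2 * m)"
proof (intro exI conjI ballI)
  define automaton where
    "automaton v = map (table (nearby_branches v) (adjacent_branches v)) [0..<m]" for v
  let ?label = "\<lambda>v. map Inl (branch 1 v) @ map Inr (automaton v)"
  have "{u, v} \<in> edges G \<longleftrightarrow> run 0 (automaton v) (branch 1 u)"
    if uv: "u \<in> verts G" "v \<in> verts G" "u \<noteq> v" for u v
    unfolding adjacent_iff_walk[OF uv] automaton_def
    using run_tables_iff_walk[OF level_nearby_branches(1)[OF uv(2)], of "[]" "branch 1 u" m]
      state_Nil[of "nearby_branches v"] length_ge_1
    by (simp add: nearby_branches_def length_branch)
  then show "decodes_adjacency run_labels G ?label"
    by (simp add: decodes_adjacency_def run_labels_append)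
  fix v assume v: "v \<in> verts G"
  have alphabet: "lists {..<valency m P} \<subseteq> lists {..<k}"
    using assms(2) by (intro lists_mono) auto
  have "table (nearby_branches v) (adjacent_branches v) n \<in> tables (Suc k) {..<k}" for n
  proof (rule table_mem_tables)
    show "nearby_branches v \<subseteq> lists {..<k}"
      using nearby_branches_subset_lists[OF v] alphabet by (rule order_trans)
    show "finite (level (nearby_branches v) n)" for n
      using v by (rule level_nearby_branches)
    show "card (level (nearby_branches v) n) \<le> Suc k" for n
      using level_nearby_branches(2)[OF v, of n] assms(1) by linarith
  qed
  moreover have "branch 1 v \<in> lists {..<k}"
    using alphabet branch_in_lists[OF order_refl v] by (rule subsetD)
  ultimately show "?label v \<in> lists (label_alphabet k)"
    by (auto simp: automaton_def label_alphabet_def)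
  show "length (?label v) \<le> 2 * m"
    by (simp add: automaton_def length_branch)
qed

lemma short_merge_width_run_labels:
  assumes "simple_graph G" and "short_merge_width 1 G \<le> enat k"
  shows "\<exists>label. decodes_adjacency run_labels G label \<and>
    (\<forall>v\<in>verts G. label v \<in> lists (label_alphabet k) \<and>
      real (length (label v)) \<le> real (2 * k) * log 2 (real (card (verts G))) + real (2 * k))"
proof -
  obtain m P R where "merge_sequence G m P R"
    and width: "radius_width 1 G m P R \<le> k" "valency m P \<le> k"
    and m: "real m \<le> real k * log 2 (real (card (verts G))) + real k"
    using assms(2) by (rule short_merge_width_leE)
  then interpret graph_merge_sequence G m P R
    using assms(1) by unfold_locales
  have "real l \<le> real (2 * k) * log 2 (real (card (verts G))) + real (2 * k)" if "l \<le> 2 * m" for l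
  proof -
    have "real l \<le> 2 * real m" using that by linarith
    also have "\<dots> \<le> real (2 * k) * log 2 (real (card (verts G))) + real (2 * k)"
      using mult_left_mono[OF m, of 2] by (simp add: algebra_simps)
    finally show ?thesis .
  qed
  then show ?thesis
    using run_labels_decodes_adjacency[OF width] by blast
qed

section \<open>Binary labelling schemes\<close>

lemma binary_code_of_words:
  assumes "finite A"
  obtains code :: "'b list \<Rightarrow> bool list" and c
  where "inj_on code (lists A)" "\<And>w. length (code w) = c * length w"
proof
  define block where "block a = map (\<lambda>i. i = to_nat_on A a) [0..<Suc (card A)]" for a
  let ?code = "\<lambda>w. concat (map block w)"
  have length_block: "length (block a) = Suc (card A)" for a
    by (simp add: block_def)
  show length_code: "length (?code w) = Suc (card A) * length w" for w
    by (induction w) (auto simp: length_block)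
  have "inj_on block A"
  proof (rule inj_onI)
    fix a b assume ab: "a \<in> A" "b \<in> A" "block a = block b"
    have "to_nat_on A a < Suc (card A)"
      using to_nat_on_less_card[OF assms ab(1)] by simp
    then have "to_nat_on A a = to_nat_on A b"
      using ab(3) unfolding block_def by (auto simp: list_eq_iff_nth_eq simp del: upt_Suc)
    then show "a = b" using ab assms by (simp add: countable_finite)
  qed
  then have inj_map: "inj_on (map block) (lists A)" by (rule inj_on_map_lists)
  show "inj_on ?code (lists A)"
  proof (rule inj_onI)
    fix v w assume vw: "v \<in> lists A" "w \<in> lists A" and eq: "?code v = ?code w"
    have "length v = length w"
      using arg_cong[OF eq, of length] unfolding length_code by (simp del: mult_Suc)
    then have "map block v = map block w"
      using eq by (intro concat_injective) (auto simp: zip_map_map length_block)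
    then show "v = w" using inj_map vw by (simp add: inj_on_eq_iff)
  qed
qed

lemma labelling_scheme_of_words:
  fixes label :: "'a graph \<Rightarrow> 'a \<Rightarrow> 'b list"
  assumes "finite A" and words: "\<And>G u. G \<in> \<C> \<Longrightarrow> u \<in> verts G \<Longrightarrow> label G u \<in> lists A"
    and decodes: "\<And>G. G \<in> \<C> \<Longrightarrow> decodes_adjacency decide G (label G)"
  obtains enc dec c
  where "labelling_scheme \<C> enc dec" "\<And>G u. length (enc G u) = c * length (label G u)"
proof -
  obtain code :: "'b list \<Rightarrow> bool list" and c
    where inj: "inj_on code (lists A)" and length: "\<And>w. length (code w) = c * length w"
    using binary_code_of_words[OF assms(1)] by blast
  let ?decode = "inv_into (lists A) code"
  have "labelling_scheme \<C> (\<lambda>G u. code (label G u)) (\<lambda>a b. decide (?decode a) (?decode b))"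
    using words decodes unfolding labelling_scheme_iff decodes_adjacency_def
    by (simp add: inv_into_f_f[OF inj])
  then show thesis using that length by blast
qed

lemma scheme_length_bigo:
  fixes f :: "nat \<Rightarrow> real"
  assumes bound: "\<And>G u. G \<in> \<C> \<Longrightarrow> u \<in> verts G \<Longrightarrow> real (length (enc G u)) \<le> f (card (verts G))"
  shows "\<exists>\<l>. (\<forall>n. scheme_length \<C> enc n = enat (\<l> n)) \<and> (\<lambda>n. real (\<l> n)) \<in> O(f)"
proof -
  define \<l> where "\<l> n = the_enat (scheme_length \<C> enc n)" for n
  have le: "scheme_length \<C> enc n \<le> enat (nat \<lfloor>f n\<rfloor>)" for n
    unfolding scheme_length_def
  proof (rule Sup_least)
    fix l assume "l \<in> {enat (length (enc G u)) | G u. G \<in> \<C> \<and> card (verts G) = n \<and> u \<in> verts G}"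
    then show "l \<le> enat (nat \<lfloor>f n\<rfloor>)" using le_nat_floor[OF bound] by auto
  qed
  then have \<l>: "scheme_length \<C> enc n = enat (\<l> n)" for n
    unfolding \<l>_def by (metis enat_ile the_enat.simps)
  have "norm (real (\<l> n)) \<le> 1 * norm (f n)" for n
    using le[of n] \<l>[of n] by simp linarith
  then have "(\<lambda>n. real (\<l> n)) \<in> O(f)"
    by (intro bigoI[of _ 1] always_eventually allI)
  then show ?thesis using \<l> by blast
qed

lemma labelling_scheme_bigo_of_words:
  fixes f :: "nat \<Rightarrow> real"
  assumes "finite A"
    and "\<And>G. G \<in> \<C> \<Longrightarrow> \<exists>label. decodes_adjacency decide G label \<and>
      (\<forall>u\<in>verts G. label u \<in> lists A \<and> real (length (label u)) \<le> f (card (verts G)))"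
  shows "\<exists>enc dec \<l>. labelling_scheme \<C> enc dec \<and>
    (\<forall>n. scheme_length \<C> enc n = enat (\<l> n)) \<and> (\<lambda>n. real (\<l> n)) \<in> O(f)"
proof -
  from bchoice[OF ballI[OF assms(2)]]
  obtain label where label: "\<forall>G\<in>\<C>. decodes_adjacency decide G (label G) \<and>
      (\<forall>u\<in>verts G. label G u \<in> lists A \<and> real (length (label G u)) \<le> f (card (verts G)))"
    by (rule exE)
  then obtain enc dec c where scheme: "labelling_scheme \<C> enc dec"
    and length_enc: "\<And>G u. length (enc G u) = c * length (label G u)"
    using labelling_scheme_of_words[OF assms(1), of \<C> label decide] by blast
  have "real (length (enc G u)) \<le> real c * f (card (verts G))" if "G \<in> \<C>" "u \<in> verts G" for G u
    using label that by (simp add: length_enc mult_left_mono)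
  from scheme_length_bigo[of \<C> enc "\<lambda>n. real c * f n", OF this]
  obtain \<l> where "\<forall>n. scheme_length \<C> enc n = enat (\<l> n)"
    and "(\<lambda>n. real (\<l> n)) \<in> O(\<lambda>n. real c * f n)" by blast
  moreover have "(\<lambda>n. real c * f n) \<in> O(f)"
    by (cases "c = 0") auto
  ultimately show ?thesis
    using scheme landau_o.big_trans by blast
qed

lemma affine_log_bigo: "(\<lambda>n. a * log 2 (real n) + b) \<in> O(\<lambda>n. log 2 (real n))"
proof (rule sum_in_bigo)
  show "(\<lambda>n. b) \<in> O(\<lambda>n. log 2 (real n))"
  proof (rule bigoI)
    show "\<forall>\<^sub>F n in sequentially. norm b \<le> \<bar>b\<bar> * norm (log 2 (real n))"
    proof (rule eventually_sequentiallyI)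
      fix n :: nat assume "2 \<le> n"
      then show "norm b \<le> \<bar>b\<bar> * norm (log 2 (real n))"
        using mult_left_mono[of 1 "log 2 (real n)" "\<bar>b\<bar>"] by simp
    qed
  qed
qed simp

theorem theorem1p5:
  fixes \<C> :: "'a graph set"
  assumes "\<forall>G\<in>\<C>. simple_graph G"
    and "(SUP G\<in>\<C>. short_merge_width 1 G) < \<infinity>"
  shows "\<exists>enc dec \<l>. labelling_scheme \<C> enc dec \<and>
    (\<forall>n. scheme_length \<C> enc n = enat (\<l> n)) \<and>
    (\<lambda>n. real (\<l> n)) \<in> O(\<lambda>n. log 2 (real n))"
proof -
  obtain k where k: "(SUP G\<in>\<C>. short_merge_width 1 G) = enat k"
    using assms(2) by auto
  let ?f = "\<lambda>n. real (2 * k) * log 2 (real n) + real (2 * k)"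
  have "\<exists>label. decodes_adjacency run_labels G label \<and>
      (\<forall>u\<in>verts G. label u \<in> lists (label_alphabet k) \<and>
        real (length (label u)) \<le> ?f (card (verts G)))"
    if "G \<in> \<C>" for G
  proof (rule short_merge_width_run_labels)
    show "simple_graph G" using assms(1) that by blast
    show "short_merge_width 1 G \<le> enat k" unfolding k[symmetric] using that by (rule SUP_upper)
  qed
  with finite_label_alphabet have "\<exists>enc dec \<l>. labelling_scheme \<C> enc dec \<and>
      (\<forall>n. scheme_length \<C> enc n = enat (\<l> n)) \<and> (\<lambda>n. real (\<l> n)) \<in> O(?f)"
    by (rule labelling_scheme_bigo_of_words)
  then show ?thesis
    using landau_o.big_trans[OF _ affine_log_bigo] by blast
qed

end
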